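(* Let $(X,d,\ll,\leq,\tau)$ be a Lorentzian pre-length space and $\Omega\colon X\to(0,+\infty)$ a continuous function. For a causal curve $\gamma\colon[a,b]\to X$ let $$L^{\tau_\Omega}(\gamma):=\inf\Big\{\sum_{i=0}^{m-1}\tau_\Omega(\gamma(t_i),\gamma(t_{i+1}))\ :\ \{t_i\}_{i=0}^m\text{ a partition of }[a,b]\Big\},$$ and let $$\hat\tau_\Omega(x,y):=\sup\big(\{0\}\cup\{L^{\tau_\Omega}(\gamma):\gamma\text{ is a causal curve from }x\text{ to }y\}\big).$$ Then $\tau_\Omega=\hat\tau_\Omega$ on $X\times X$.
   Context: A Lorentzian pre-length space $(X,d,\ll,\leq,\tau)$ consists of a set $X$, a metric $d$ on $X$, two transitive relations $\ll,\leq$ on $X$ with $\leq$ reflexive and $\ll$ contained in $\leq$, and a map $\tau\colon X\times X\to[0,+\infty]$ which is lower semicontinuous with respect to the topology of $d$, satisfies $\tau(x,z)\geq\tau(x,y)+\tau(y,z)$ whenever $x\leq y\leq z$, satisfies $\tau(x,y)=0$ if $x\not\leq y$, and satisfies $\tau(x,y)>0$ if and only if $x\ll y$. A curve is a continuous map from an interval into $X$. A non-constant curve $\gamma\colon I\to X$ is causal if $\gamma(t)\leq\gamma(s)$ for all $t<s$ in $I$. A causal curve from $x$ to $y$ is one defined on a compact interval, starting at $x$ and ending at $y$. For a causal curve $\gamma\colon[a,b]\to X$ put $$L_\Omega^\tau(\gamma):=\inf\Big\{\sum_{i=0}^{m-1}\max_{t\in[t_i,t_{i+1}]}\Omega(\gamma(t))\,\tau(\gamma(t_i),\gamma(t_{i+1}))\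 :\ a=t_0<\dots<t_m=b\Big\},$$ and define $$\tau_\Omega(x,y):=\sup\big(\{0\}\cup\{L_\Omega^\tau(\gamma):\gamma\text{ a causal curve from }x\text{ to }y\}\big).$$ *)

theory Defs
  imports "HOL-Analysis.Analysis"
begin

text \<open>Only the values of \<open>ll\<close>, \<open>le\<close> and \<open>\<tau>\<close> on \<open>X\<close> are relevant. Lower semicontinuity of \<open>\<tau>\<close>
  on the product space is stated as openness of all strict superlevel sets.\<close>

locale Lorentzian_pre_length_space = Metric_space X d
  for X :: "'a set" and d :: "'a \<Rightarrow> 'a \<Rightarrow> real" +
  fixes ll le :: "'a \<Rightarrow> 'a \<Rightarrow> bool"
    and \<tau> :: "'a \<Rightarrow> 'a \<Rightarrow> ennreal"
  assumes ll_trans: "\<lbrakk>x \<in> X; y \<in> X; z \<in> X; ll x y; ll y z\<rbrakk> \<Longrightarrow> ll x z"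
    and le_trans: "\<lbrakk>x \<in> X; y \<in> X; z \<in> X; le x y; le y z\<rbrakk> \<Longrightarrow> le x z"
    and le_refl: "x \<in> X \<Longrightarrow> le x x"
    and ll_imp_le: "\<lbrakk>x \<in> X; y \<in> X; ll x y\<rbrakk> \<Longrightarrow> le x y"
    and tau_lower_semicontinuous:
      "\<And>c. openin (prod_topology mtopology mtopology) {(x, y) \<in> X \<times> X. c < \<tau> x y}"
    and tau_reverse_triangle:
      "\<lbrakk>x \<in> X; y \<in> X; z \<in> X; le x y; le y z\<rbrakk> \<Longrightarrow> \<tau> x y + \<tau> y z \<le> \<tau> x z"
    and tau_eq_0: "\<lbrakk>x \<in> X; y \<in> X; \<not> le x y\<rbrakk> \<Longrightarrow> \<tau> x y = 0"
    and tau_pos_iff: "\<lbrakk>x \<in> X; y \<in> X\<rbrakk> \<Longrightarrow> 0 < \<tau> x y \<longleftrightarrow> ll x y"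

definition causal_curve ::
  "'a set \<Rightarrow> ('a \<Rightarrow> 'a \<Rightarrow> real) \<Rightarrow> ('a \<Rightarrow> 'a \<Rightarrow> bool) \<Rightarrow> real set \<Rightarrow> (real \<Rightarrow> 'a) \<Rightarrow> bool" where
  "causal_curve X d le I \<gamma> \<longleftrightarrow>
     is_interval I \<and>
     continuous_map (top_of_set I) (Metric_space.mtopology X d) \<gamma> \<and>
     \<not> \<gamma> constant_on I \<and>
     (\<forall>t\<in>I. \<forall>s\<in>I. t < s \<longrightarrow> le (\<gamma> t) (\<gamma> s))"

definition causal_curve_from_to ::
  "'a set \<Rightarrow> ('a \<Rightarrow> 'a \<Rightarrow> real) \<Rightarrow> ('a \<Rightarrow> 'a \<Rightarrow> bool) \<Rightarrow> 'a \<Rightarrow> 'a \<Rightarrow> real \<Rightarrow> real \<Rightarrow> (real \<Rightarrow> 'a) \<Rightarrow> bool"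
where
  "causal_curve_from_to X d le x y a b \<gamma> \<longleftrightarrow>
     a \<le> b \<and> causal_curve X d le {a..b} \<gamma> \<and> \<gamma> a = x \<and> \<gamma> b = y"

text \<open>The points of a partition are \<open>t 0, \<dots>, t m\<close>; the values of \<open>t\<close> beyond \<open>m\<close> play no role.\<close>

definition interval_partition :: "real \<Rightarrow> real \<Rightarrow> nat \<Rightarrow> (nat \<Rightarrow> real) \<Rightarrow> bool" where
  "interval_partition a b m t \<longleftrightarrow> t 0 = a \<and> t m = b \<and> (\<forall>i<m. t i < t (Suc i))"

definition tau_length :: "('a \<Rightarrow> 'a \<Rightarrow> ennreal) \<Rightarrow> real \<Rightarrow> real \<Rightarrow> (real \<Rightarrow> 'a) \<Rightarrow> ennreal" where
  "tau_length \<sigma> a b \<gamma> =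
     Inf {\<Sum>i<m. \<sigma> (\<gamma> (t i)) (\<gamma> (t (Suc i))) | m t. interval_partition a b m t}"

text \<open>The real-valued supremum below is a maximum whenever \<open>\<Omega>\<close> and \<open>\<gamma>\<close> are continuous.\<close>

definition weighted_length ::
  "('a \<Rightarrow> real) \<Rightarrow> ('a \<Rightarrow> 'a \<Rightarrow> ennreal) \<Rightarrow> real \<Rightarrow> real \<Rightarrow> (real \<Rightarrow> 'a) \<Rightarrow> ennreal" where
  "weighted_length \<Omega> \<tau> a b \<gamma> =
     Inf {\<Sum>i<m. ennreal (SUP s\<in>{t i..t (Suc i)}. \<Omega> (\<gamma> s)) * \<tau> (\<gamma> (t i)) (\<gamma> (t (Suc i)))
          | m t. interval_partition a b m t}"

definition conformal_tau ::
  "'a set \<Rightarrow> ('a \<Rightarrow> 'a \<Rightarrow> real) \<Rightarrow> ('a \<Rightarrow> 'a \<Rightarrow> bool) \<Rightarrow> ('a \<Rightarrow> 'a \<Rightarrow> ennreal) \<Rightarrow> ('a \<Rightarrow> real)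
    \<Rightarrow> 'a \<Rightarrow> 'a \<Rightarrow> ennreal" where
  "conformal_tau X d le \<tau> \<Omega> x y =
     Sup ({0} \<union> {weighted_length \<Omega> \<tau> a b \<gamma> | a b \<gamma>. causal_curve_from_to X d le x y a b \<gamma>})"

definition intrinsic_tau ::
  "'a set \<Rightarrow> ('a \<Rightarrow> 'a \<Rightarrow> real) \<Rightarrow> ('a \<Rightarrow> 'a \<Rightarrow> bool) \<Rightarrow> ('a \<Rightarrow> 'a \<Rightarrow> ennreal)
    \<Rightarrow> 'a \<Rightarrow> 'a \<Rightarrow> ennreal" where
  "intrinsic_tau X d le \<sigma> x y =
     Sup ({0} \<union> {tau_length \<sigma> a b \<gamma> | a b \<gamma>. causal_curve_from_to X d le x y a b \<gamma>})"

end

theory Submission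
  imports Defs
begin

text \<open>
  Write \<open>\<sigma>\<close> for the conformal time separation and \<open>L\<close> for the weighted length. Evaluating the
  \<open>\<sigma>\<close>-length of a curve on the partition consisting of its two end points shows that the
  intrinsic time separation of \<open>\<sigma>\<close> never exceeds \<open>\<sigma>\<close>.

  For the converse, \<open>L(\<gamma>) \<le> (\<Sum>i. \<sigma> (\<gamma> (t i)) (\<gamma> (t (Suc i))))\<close> is needed for every
  causal curve \<open>\<gamma>\<close> and every partition \<open>t\<close>. Concatenating partitions shows that \<open>L\<close> is
  subadditive (\<open>weighted_length_triangle\<close>), so it is enough to bound \<open>L\<close> of each piece of
  \<open>\<gamma>\<close> by \<open>\<sigma>\<close> of its end points (\<open>weighted_length_le_conformal_tau\<close>). If the piece is not
  constant, it is a competitor in the supremum that defines \<open>\<sigma>\<close>.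

  A piece that is constant, with value \<open>p\<close>, is not a causal curve. The reverse triangle
  inequality forces \<open>\<tau> p p\<close> to be \<open>0\<close> or \<open>\<infinity>\<close>. In the first case the piece has length \<open>0\<close>. In the
  second, lower semicontinuity of \<open>\<tau>\<close> provides, for each finite \<open>c\<close>, a neighbourhood \<open>U\<close> of \<open>p\<close>
  in which any two points have time separation above \<open>c\<close>. As \<open>\<gamma>\<close> itself is not constant, it
  leaves \<open>p\<close> somewhere, and running a short way out and back along \<open>\<gamma>\<close> inside \<open>U\<close> is a causal
  loop at \<open>p\<close> of length at least \<open>\<Omega> p * c\<close>. Hence \<open>\<sigma> p p = \<infinity>\<close>
  (\<open>conformal_tau_self_eq_top\<close>).
\<close>

section \<open>Subadditivity of the weighted length\<close>

lemma ennreal_le_Inf_add_Inf: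
  fixes x :: ennreal
  assumes "\<And>A B. A \<in> S \<Longrightarrow> B \<in> T \<Longrightarrow> x \<le> A + B"
  shows "x \<le> Inf S + Inf T"
proof -
  have le_add_Inf: "x \<le> a + Inf R" if "\<And>r. r \<in> R \<Longrightarrow> x \<le> a + r" for a and R :: "ennreal set"
  proof (cases "a = top")
    case False
    then have "x - a \<le> Inf R"
      using that by (intro Inf_greatest) (simp add: ennreal_minus_le_iff)
    then show ?thesis
      by (simp add: ennreal_minus_le_iff)
  qed simp
  have "x \<le> Inf T + A" if "A \<in> S" for A
    using le_add_Inf[of T A] assms[OF that] by (simp add: add.commute[of _ A])
  then show ?thesis
    using le_add_Inf[of S "Inf T"] by (simp add: add.commute)
qed

lemma interval_partition_trivial:
  "a < b \<Longrightarrow> interval_partition a b 1 (\<lambda>i. if i = 0 then a else b)"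
  by (simp add: interval_partition_def)

lemma interval_partition_concat:
  assumes "interval_partition a b m t" "interval_partition b c n s"
  shows "interval_partition a c (m + n) (\<lambda>i. if i \<le> m then t i else s (i - m))"
  unfolding interval_partition_def
proof (intro conjI allI impI)
  fix i assume i: "i < m + n"
  show "(if i \<le> m then t i else s (i - m)) < (if Suc i \<le> m then t (Suc i) else s (Suc i - m))"
  proof (cases i m rule: linorder_cases)
    case equal
    then have "t i = s 0" "s 0 < s (Suc 0)"
      using assms i by (auto simp: interval_partition_def)
    with equal show ?thesis by simp
  next
    case greater
    then have "s (i - m) < s (Suc (i - m))"
      using assms(2) i by (auto simp: interval_partition_def)
    with greater show ?thesis by (simp add: Suc_diff_le)
  qed (use assms in \<open>auto simp: interval_partition_def\<close>)
qed (use assms in \<open>auto simp: interval_partition_def\<close>)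

lemma interval_partition_mono:
  assumes "interval_partition a b m t" "i \<le> j" "j \<le> m"
  shows "t i \<le> t j"
  using assms(2,3)
proof (induction j rule: dec_induct)
  case (step k)
  then have "t i \<le> t k" "t k < t (Suc k)"
    using assms(1) by (auto simp: interval_partition_def)
  then show ?case by simp
qed simp

lemma interval_partition_prefix:
  "interval_partition a b m t \<Longrightarrow> k \<le> m \<Longrightarrow> interval_partition a (t k) k t"
  by (simp add: interval_partition_def)

lemma weighted_length_le_sum:
  "interval_partition a b m t \<Longrightarrow>
    weighted_length \<Omega> \<tau> a b \<gamma>
      \<le> (\<Sum>i<m. ennreal (SUP s\<in>{t i..t (Suc i)}. \<Omega> (\<gamma> s)) * \<tau> (\<gamma> (t i)) (\<gamma> (t (Suc i))))"
  unfolding weighted_length_def by (intro Inf_lower) blast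

lemma weighted_length_triangle:
  "weighted_length \<Omega> \<tau> a c \<gamma> \<le> weighted_length \<Omega> \<tau> a b \<gamma> + weighted_length \<Omega> \<tau> b c \<gamma>"
  unfolding weighted_length_def[of \<Omega> \<tau> a b \<gamma>] weighted_length_def[of \<Omega> \<tau> b c \<gamma>]
proof (rule ennreal_le_Inf_add_Inf, safe)
  fix m n and t s :: "nat \<Rightarrow> real"
  assume ts: "interval_partition a b m t" "interval_partition b c n s"
  define F where
    "F u v = ennreal (SUP r\<in>{u..v}. \<Omega> (\<gamma> r)) * \<tau> (\<gamma> u) (\<gamma> v)" for u v
  define w where "w i = (if i \<le> m then t i else s (i - m))" for i
  have "t m = s 0"
    using ts by (simp add: interval_partition_def)
  then have shift: "w (m + i) = s i" for i
    by (simp add: w_def)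
  have "weighted_length \<Omega> \<tau> a c \<gamma> \<le> (\<Sum>i<m+n. F (w i) (w (Suc i)))"
    unfolding F_def
    by (intro weighted_length_le_sum, unfold w_def, rule interval_partition_concat[OF ts])
  also have "\<dots> = (\<Sum>i<m. F (w i) (w (Suc i))) + (\<Sum>i<n. F (w (m + i)) (w (m + Suc i)))"
    by (induction n) (simp_all add: add.assoc)
  also have "(\<Sum>i<m. F (w i) (w (Suc i))) = (\<Sum>i<m. F (t i) (t (Suc i)))"
    by (intro sum.cong) (auto simp: w_def)
  finally show "weighted_length \<Omega> \<tau> a c \<gamma> \<le>
    (\<Sum>i<m. ennreal (SUP s\<in>{t i..t (Suc i)}. \<Omega> (\<gamma> s)) * \<tau> (\<gamma> (t i)) (\<gamma> (t (Suc i)))) +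
    (\<Sum>i<n. ennreal (SUP s\<in>{s i..s (Suc i)}. \<Omega> (\<gamma> s)) * \<tau> (\<gamma> (s i)) (\<gamma> (s (Suc i))))"
    unfolding shift F_def .
qed

lemma weighted_length_le_sum_pieces:
  assumes "interval_partition a b m t"
  shows "weighted_length \<Omega> \<tau> a b \<gamma> \<le> (\<Sum>i<m. weighted_length \<Omega> \<tau> (t i) (t (Suc i)) \<gamma>)"
  using assms
proof (induction m arbitrary: b)
  case 0
  then show ?case
    using weighted_length_le_sum[OF "0.prems", of \<Omega> \<tau> \<gamma>] by simp
next
  case (Suc m)
  have "b = t (Suc m)"
    using Suc.prems by (simp add: interval_partition_def)
  then have "weighted_length \<Omega> \<tau> a b \<gamma>
      \<le> weighted_length \<Omega> \<tau> a (t m) \<gamma> + weighted_length \<Omega> \<tau> (t m) (t (Suc m)) \<gamma>"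
    using weighted_length_triangle by blast
  also have "\<dots> \<le> (\<Sum>i<Suc m. weighted_length \<Omega> \<tau> (t i) (t (Suc i)) \<gamma>)"
    using Suc.IH[OF interval_partition_prefix[OF Suc.prems, of m]] by (simp add: add_right_mono)
  finally show ?case .
qed

text \<open>
  Every partition has a first piece, and \<open>\<gamma> a\<close> is one of the points over which the weight of
  that piece is maximised.
\<close>

lemma first_term_le_weighted_length:
  assumes "a < b"
    and bdd: "bdd_above ((\<lambda>s. \<Omega> (\<gamma> s)) ` {a..b})"
    and c: "\<And>t. t \<in> {a..b} \<Longrightarrow> c \<le> \<tau> (\<gamma> a) (\<gamma> t)"
  shows "ennreal (\<Omega> (\<gamma> a)) * c \<le> weighted_length \<Omega> \<tau> a b \<gamma>"
  unfolding weighted_length_def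
proof (rule Inf_greatest, safe)
  fix m t assume t: "interval_partition a b m t"
  let ?F = "\<lambda>i. ennreal (SUP s\<in>{t i..t (Suc i)}. \<Omega> (\<gamma> s)) * \<tau> (\<gamma> (t i)) (\<gamma> (t (Suc i)))"
  have t0: "t 0 = a" and m: "0 < m"
    using t \<open>a < b\<close> by (auto simp: interval_partition_def intro: Suc_leI gr0I)
  have t1: "t (Suc 0) \<in> {a..b}"
    using interval_partition_mono[OF t, of 0 "Suc 0"] interval_partition_mono[OF t, of "Suc 0" m]
      t m by (auto simp: interval_partition_def)
  have "\<Omega> (\<gamma> a) \<le> (SUP s\<in>{a..t (Suc 0)}. \<Omega> (\<gamma> s))"
    using t1 by (intro cSUP_upper bdd_above_mono[OF bdd]) auto
  then have "ennreal (\<Omega> (\<gamma> a)) * c \<le> ?F 0"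
    using t0 c[OF t1] by (auto intro!: mult_mono ennreal_leI)
  also have "\<dots> \<le> (\<Sum>i<m. ?F i)"
    using m by (intro member_le_sum) auto
  finally show "ennreal (\<Omega> (\<gamma> a)) * c \<le> (\<Sum>i<m. ?F i)" .
qed

section \<open>Points of infinite self-separation\<close>

lemma weighted_length_le_conformal_tau_ends:
  "causal_curve_from_to X d le x y a b \<gamma> \<Longrightarrow>
    weighted_length \<Omega> \<tau> a b \<gamma> \<le> conformal_tau X d le \<tau> \<Omega> x y"
  unfolding conformal_tau_def by (intro Sup_upper) blast

lemma causal_curve_from_to_less:
  assumes "causal_curve_from_to X d le x y a b \<gamma>"
  shows "a < b"
proof (rule ccontr)
  assume "\<not> a < b"
  then have "b = a"
    using assms by (simp add: causal_curve_from_to_def)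
  then have "\<gamma> constant_on {a..b}"
    by (simp add: constant_on_def)
  then show False
    using assms by (simp add: causal_curve_from_to_def causal_curve_def)
qed

text \<open>
  The times at which a curve is at \<open>p\<close> form a closed subset of its domain; by connectedness
  of the interval, this set cannot also be open.
\<close>

lemma (in Metric_space) curve_leaves_point:
  fixes \<gamma> :: "real \<Rightarrow> 'a"
  assumes \<gamma>: "continuous_map (top_of_set {a..b}) mtopology \<gamma>"
    and ends: "q \<in> {a..b}" "\<gamma> q = p" "s \<in> {a..b}" "\<gamma> s \<noteq> p"
    and U: "openin mtopology U" "p \<in> U"
  obtains v w where "v \<in> {a..b}" "w \<in> {a..b}" "\<gamma> v = p" "\<gamma> w \<noteq> p"
    and "\<gamma> ` closed_segment v w \<subseteq> U"
proof -
  define K where "K = {t \<in> {a..b}. \<gamma> t = p}"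
  define V where "V = {t \<in> {a..b}. \<gamma> t \<in> U}"
  have "p \<in> M"
    using U openin_subset by fastforce
  then have "closedin mtopology {p}"
    using Hausdorff_space_mtopology by (simp add: closedin_Hausdorff_singleton)
  then have "closedin (top_of_set {a..b}) K"
    using closedin_continuous_map_preimage[OF \<gamma>, of "{p}"] by (simp add: K_def)
  moreover have "K \<noteq> {}" "K \<noteq> {a..b}"
    using ends unfolding K_def by blast+
  ultimately have "\<not> openin (top_of_set {a..b}) K"
    using connected_clopen[of "{a..b}"] connected_Icc[of a b] by metis
  then obtain v where v: "v \<in> K" "\<And>e. e > 0 \<Longrightarrow> \<exists>w\<in>{a..b}. dist w v < e \<and> w \<notin> K"
    unfolding openin_euclidean_subtopology_iff K_def by blast
  have "openin (top_of_set {a..b}) V"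
    using openin_continuous_map_preimage[OF \<gamma> U(1)] by (simp add: V_def)
  moreover have "v \<in> V"
    using v(1) U(2) by (auto simp: K_def V_def)
  ultimately obtain e where e: "e > 0" "\<And>t. t \<in> {a..b} \<Longrightarrow> dist t v < e \<Longrightarrow> t \<in> V"
    unfolding openin_euclidean_subtopology_iff by blast
  obtain w where w: "w \<in> {a..b}" "dist w v < e" "w \<notin> K"
    using v(2)[OF e(1)] by blast
  have vab: "v \<in> {a..b}"
    using v(1) by (simp add: K_def)
  have "t \<in> V" if t: "t \<in> closed_segment v w" for t
  proof (rule e(2))
    show "t \<in> {a..b}"
      using t vab w(1) by (auto simp: closed_segment_eq_real_ivl split: if_splits)
    show "dist t v < e"
      using t w(2) by (auto simp: closed_segment_eq_real_ivl dist_real_def split: if_splits)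
  qed
  then have "\<gamma> ` closed_segment v w \<subseteq> U"
    by (auto simp: V_def)
  with that[of v w] vab v(1) w show ?thesis
    by (auto simp: K_def)
qed

context Lorentzian_pre_length_space
begin

lemma tau_self_cases:
  assumes "p \<in> X"
  shows "\<tau> p p = 0 \<or> \<tau> p p = top"
proof (cases "\<tau> p p")
  case (real r)
  have "\<tau> p p + \<tau> p p \<le> \<tau> p p"
    using assms by (intro tau_reverse_triangle le_refl) auto
  then show ?thesis
    using real by (simp flip: ennreal_plus)
qed simp

text \<open>
  A superlevel set that is open in the product contains a box around \<open>(p, p)\<close>; intersecting its
  two sides gives a single neighbourhood, which controls both orders of each pair.
\<close>

lemma tau_large_neighbourhood:
  assumes "p \<in> X" "c < \<tau> p p"
  obtains U where "openin mtopology U" "p \<in> U" "U \<subseteq> X"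
    and "\<And>x y. x \<in> U \<Longrightarrow> y \<in> U \<Longrightarrow> c < \<tau> x y"
proof -
  define S where "S = {(x, y) \<in> X \<times> X. c < \<tau> x y}"
  have "openin (prod_topology mtopology mtopology) S" "(p, p) \<in> S"
    using tau_lower_semicontinuous[of c] assms by (auto simp: S_def)
  then obtain V W where VW:
    "openin mtopology V" "openin mtopology W" "p \<in> V" "p \<in> W"
    "V \<times> W \<subseteq> S"
    unfolding openin_prod_topology_alt by metis
  show ?thesis
  proof (rule that[of "V \<inter> W"])
    show "V \<inter> W \<subseteq> X"
      using openin_subset[OF VW(1)] by auto
    show "c < \<tau> x y" if "x \<in> V \<inter> W" "y \<in> V \<inter> W" for x y
      using that VW(5) by (auto simp: S_def)
  qed (use VW in auto)
qed

text \<open>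
  In a region where every pair of points is chronologically related, both a curve and its
  reverse are causal, so running along \<open>\<gamma>\<close> from \<open>p\<close> to a nearby point and back is a causal loop.
\<close>

lemma conformal_tau_self_eq_top:
  fixes \<gamma> :: "real \<Rightarrow> 'a"
  assumes \<Omega>: "continuous_map mtopology euclideanreal \<Omega>" "\<forall>x\<in>X. 0 < \<Omega> x"
    and \<gamma>: "continuous_map (top_of_set {a..b}) mtopology \<gamma>" "\<not> \<gamma> constant_on {a..b}"
    and q: "q \<in> {a..b}" "\<gamma> q = p"
    and infinite_tau: "\<tau> p p = top"
  shows "conformal_tau X d le \<tau> \<Omega> p p = top"
proof -
  have p: "p \<in> X"
    using continuous_map_image_subset_topspace[OF \<gamma>(1)] q by auto
  obtain s where s: "s \<in> {a..b}" "\<gamma> s \<noteq> p"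
    using \<gamma>(2) unfolding constant_on_def by blast
  have bound: "ennreal (\<Omega> p) * of_nat n \<le> conformal_tau X d le \<tau> \<Omega> p p" for n
  proof -
    have "of_nat n < \<tau> p p"
      by (simp add: infinite_tau of_nat_less_top)
    then obtain U where U: "openin mtopology U" "p \<in> U" "U \<subseteq> X"
      and large: "\<And>x y. x \<in> U \<Longrightarrow> y \<in> U \<Longrightarrow> of_nat n < \<tau> x y"
      using tau_large_neighbourhood[OF p] by metis
    obtain v w where vw: "v \<in> {a..b}" "w \<in> {a..b}" "\<gamma> v = p" "\<gamma> w \<noteq> p"
      and seg: "\<gamma> ` closed_segment v w \<subseteq> U"
      using curve_leaves_point[OF \<gamma>(1) q s U(1,2)] by metis
    \<comment> \<open>At time \<open>-1\<close> and time \<open>1\<close> the loop is at \<open>\<gamma> v = p\<close>, at time \<open>0\<close> it is at the turning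
      point \<open>\<gamma> w\<close>; this formula does not depend on which of \<open>v\<close>, \<open>w\<close> comes first.\<close>
    define f where "f t = w + (v - w) * \<bar>t\<bar>" for t :: real
    define \<eta> where "\<eta> = \<gamma> \<circ> f"
    have f: "f t \<in> closed_segment v w" if "t \<in> {-1..1}" for t
      unfolding closed_segment_def f_def using that
      by (auto intro!: exI[of _ "1 - \<bar>t\<bar>"] simp: algebra_simps)
    have sub: "closed_segment v w \<subseteq> {a..b}"
      using vw(1,2) by (intro closed_segment_subset) auto
    have \<eta>U: "\<eta> t \<in> U" if "t \<in> {-1..1}" for t
      using f[OF that] seg by (auto simp: \<eta>_def)
    have "continuous_map (top_of_set {-1..1}) (top_of_set {a..b}) f"
      using f sub by (auto simp: continuous_map_in_subtopology f_def intro!: continuous_intros)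
    then have cont: "continuous_map (top_of_set {-1..1}) mtopology \<eta>"
      unfolding \<eta>_def using \<gamma>(1) by (rule continuous_map_compose)
    have "\<eta> 0 \<noteq> \<eta> 1"
      using vw by (simp add: \<eta>_def f_def)
    then have "\<not> \<eta> constant_on {-1..1}"
      unfolding constant_on_def by force
    moreover have "le (\<eta> t) (\<eta> s)" if "t \<in> {-1..1}" "s \<in> {-1..1}" for t s
    proof -
      have "0 < \<tau> (\<eta> t) (\<eta> s)"
        using large[OF \<eta>U[OF that(1)] \<eta>U[OF that(2)]] by (rule le_less_trans[OF zero_le])
      moreover have "\<eta> t \<in> X" "\<eta> s \<in> X"
        using \<eta>U that U(3) by auto
      ultimately show ?thesis
        using tau_pos_iff ll_imp_le by blast
    qed
    ultimately have "causal_curve_from_to X d le p p (-1) 1 \<eta>"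
      using cont vw(3) is_interval_cc
      by (auto simp: causal_curve_from_to_def causal_curve_def \<eta>_def f_def)
    then have *: "weighted_length \<Omega> \<tau> (-1) 1 \<eta> \<le> conformal_tau X d le \<tau> \<Omega> p p"
      by (rule weighted_length_le_conformal_tau_ends)
    have "continuous_map (top_of_set {-1..1}) euclideanreal (\<Omega> \<circ> \<eta>)"
      using cont \<Omega>(1) by (rule continuous_map_compose)
    then have "continuous_on {-1..1} (\<lambda>s. \<Omega> (\<eta> s))"
      by (simp add: o_def)
    then have bdd: "bdd_above ((\<lambda>s. \<Omega> (\<eta> s)) ` {-1..1})"
      by (intro bounded_imp_bdd_above compact_imp_bounded compact_continuous_image) auto
    have "\<eta> (-1) = p"
      using vw(3) by (simp add: \<eta>_def f_def)
    moreover have "of_nat n \<le> \<tau> (\<eta> (-1)) (\<eta> t)" if "t \<in> {-1..1}" for t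
      using large[OF \<eta>U \<eta>U[OF that], of "-1"] by (simp add: less_imp_le)
    ultimately have "ennreal (\<Omega> p) * of_nat n \<le> weighted_length \<Omega> \<tau> (-1) 1 \<eta>"
      using first_term_le_weighted_length[of "-1" 1 \<Omega> \<eta> "of_nat n" \<tau>] bdd by simp
    also note *
    finally show ?thesis .
  qed
  have "ennreal (\<Omega> p) * top = (SUP n. ennreal (\<Omega> p) * of_nat n)"
    by (simp only: ennreal_SUP_of_nat_eq_top flip: SUP_mult_left_ennreal)
  also have "\<dots> \<le> conformal_tau X d le \<tau> \<Omega> p p"
    using bound by (intro SUP_least)
  finally have "ennreal (\<Omega> p) * top \<le> conformal_tau X d le \<tau> \<Omega> p p" .
  moreover have "ennreal (\<Omega> p) \<noteq> 0"
    using \<Omega>(2) p by (simp add: ennreal_eq_0_iff not_le)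
  ultimately show ?thesis
    by (simp add: ennreal_mult_top top_unique)
qed

section \<open>Weighted length of the pieces of a causal curve\<close>

text \<open>
  The delicate piece is a constant one: it is excluded from the supremum defining the right-hand
  side, and the bound then depends on the whole curve not being constant.
\<close>

lemma weighted_length_le_conformal_tau:
  assumes \<Omega>: "continuous_map mtopology euclideanreal \<Omega>" "\<forall>x\<in>X. 0 < \<Omega> x"
    and \<gamma>: "causal_curve X d le {a..b} \<gamma>"
    and uv: "a \<le> u" "u < v" "v \<le> b"
  shows "weighted_length \<Omega> \<tau> u v \<gamma> \<le> conformal_tau X d le \<tau> \<Omega> (\<gamma> u) (\<gamma> v)"
proof (cases "\<gamma> constant_on {u..v}")
  case False
  have "continuous_map (top_of_set {u..v}) mtopology \<gamma>"
    using \<gamma> uv by (auto simp: causal_curve_def intro: continuous_map_from_subtopology_mono)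
  then have "causal_curve_from_to X d le (\<gamma> u) (\<gamma> v) u v \<gamma>"
    using \<gamma> uv False by (auto simp: causal_curve_from_to_def causal_curve_def is_interval_cc)
  then show ?thesis
    by (rule weighted_length_le_conformal_tau_ends)
next
  case True
  then have eq: "\<gamma> v = \<gamma> u"
    using uv unfolding constant_on_def by force
  have cont: "continuous_map (top_of_set {a..b}) mtopology \<gamma>" and nonconst: "\<not> \<gamma> constant_on {a..b}"
    using \<gamma> by (auto simp: causal_curve_def)
  have "\<gamma> u \<in> X"
    using continuous_map_image_subset_topspace[OF cont] uv by auto
  then consider "\<tau> (\<gamma> u) (\<gamma> u) = 0" | "\<tau> (\<gamma> u) (\<gamma> u) = top"
    using tau_self_cases by blast
  then show ?thesis
  proof cases
    case 1
    then have "weighted_length \<Omega> \<tau> u v \<gamma> \<le> 0"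
      using weighted_length_le_sum[OF interval_partition_trivial[OF uv(2)], of \<Omega> \<tau> \<gamma>] eq by simp
    then show ?thesis by simp
  next
    case 2
    then show ?thesis
      using conformal_tau_self_eq_top[OF \<Omega> cont nonconst, of u] uv eq by simp
  qed
qed

lemma weighted_length_le_tau_length:
  assumes "continuous_map mtopology euclideanreal \<Omega>" "\<forall>x\<in>X. 0 < \<Omega> x"
    and "causal_curve X d le {a..b} \<gamma>"
  shows "weighted_length \<Omega> \<tau> a b \<gamma> \<le> tau_length (conformal_tau X d le \<tau> \<Omega>) a b \<gamma>"
  unfolding tau_length_def
proof (rule Inf_greatest, safe)
  fix m t assume t: "interval_partition a b m t"
  have "weighted_length \<Omega> \<tau> a b \<gamma> \<le> (\<Sum>i<m. weighted_length \<Omega> \<tau> (t i) (t (Suc i)) \<gamma>)"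
    by (rule weighted_length_le_sum_pieces[OF t])
  also have "\<dots> \<le> (\<Sum>i<m. conformal_tau X d le \<tau> \<Omega> (\<gamma> (t i)) (\<gamma> (t (Suc i))))"
  proof (intro sum_mono weighted_length_le_conformal_tau[OF assms])
    fix i assume "i \<in> {..<m}"
    then show "a \<le> t i" "t i < t (Suc i)" "t (Suc i) \<le> b"
      using t interval_partition_mono[OF t, of 0 i] interval_partition_mono[OF t, of "Suc i" m]
      by (auto simp: interval_partition_def)
  qed
  finally show "weighted_length \<Omega> \<tau> a b \<gamma>
      \<le> (\<Sum>i<m. conformal_tau X d le \<tau> \<Omega> (\<gamma> (t i)) (\<gamma> (t (Suc i))))" .
qed

end

lemma tau_length_le_sum:
  "interval_partition a b m t \<Longrightarrow>
    tau_length \<sigma> a b \<gamma> \<le> (\<Sum>i<m. \<sigma> (\<gamma> (t i)) (\<gamma> (t (Suc i))))"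
  unfolding tau_length_def by (intro Inf_lower) blast

lemma intrinsic_tau_le: "intrinsic_tau X d le \<sigma> x y \<le> \<sigma> x y"
  unfolding intrinsic_tau_def
proof (rule Sup_least, safe)
  fix a b \<gamma> assume \<gamma>: "causal_curve_from_to X d le x y a b \<gamma>"
  from interval_partition_trivial[OF causal_curve_from_to_less[OF \<gamma>]]
  show "tau_length \<sigma> a b \<gamma> \<le> \<sigma> x y"
    using tau_length_le_sum \<gamma> by (fastforce simp: causal_curve_from_to_def)
qed simp_all

theorem proposition3p9:
  fixes X :: "'a set" and d :: "'a \<Rightarrow> 'a \<Rightarrow> real"
    and ll le :: "'a \<Rightarrow> 'a \<Rightarrow> bool"
    and \<tau> :: "'a \<Rightarrow> 'a \<Rightarrow> ennreal"
    and \<Omega> :: "'a \<Rightarrow> real"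
  assumes "Lorentzian_pre_length_space X d ll le \<tau>"
    and "continuous_map (Metric_space.mtopology X d) euclideanreal \<Omega>"
    and "\<forall>x\<in>X. 0 < \<Omega> x"
  shows "\<forall>x\<in>X. \<forall>y\<in>X.
    conformal_tau X d le \<tau> \<Omega> x y = intrinsic_tau X d le (conformal_tau X d le \<tau> \<Omega>) x y"
proof (intro ballI antisym intrinsic_tau_le)
  fix x y
  interpret Lorentzian_pre_length_space X d ll le \<tau> by fact
  show "conformal_tau X d le \<tau> \<Omega> x y \<le> intrinsic_tau X d le (conformal_tau X d le \<tau> \<Omega>) x y"
    unfolding conformal_tau_def[of X d le \<tau> \<Omega> x y]
  proof (rule Sup_least, safe)
    fix a b \<gamma> assume \<gamma>: "causal_curve_from_to X d le x y a b \<gamma>"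
    then have "weighted_length \<Omega> \<tau> a b \<gamma> \<le> tau_length (conformal_tau X d le \<tau> \<Omega>) a b \<gamma>"
      by (intro weighted_length_le_tau_length[OF assms(2,3)])
        (simp add: causal_curve_from_to_def)
    also have "\<dots> \<le> intrinsic_tau X d le (conformal_tau X d le \<tau> \<Omega>) x y"
      unfolding intrinsic_tau_def using \<gamma> by (intro Sup_upper) blast
    finally show "weighted_length \<Omega> \<tau> a b \<gamma>
      \<le> intrinsic_tau X d le (conformal_tau X d le \<tau> \<Omega>) x y" .
  qed simp_all
qed

end
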